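(* Let $\mathcal X$ be a finite alphabet, $\mathcal M$ a countable set of probability distributions on sequences over $\mathcal X$, and $\xi=\sum_{\nu\in\mathcal M}w_\nu\nu$ with $w_\nu>0$, $\sum_{\nu\in\mathcal M} w_\nu=1$. Then $\xi$ is Pareto-optimal with respect to each of the following performance measures $\mathcal F(\nu,\rho)$: the instantaneous and total squared distances $s_t$ and $S_n$, the instantaneous and total entropy distances $d_t$ and $D_n$, the instantaneous and total expected errors $e_t$ and $E_n$, and the instantaneous and total expected losses $l_t$ and $L_n$. That is, for each such $\mathcal F$, there is no probability distribution $\rho$ with $\mathcal F(\nu,\rho)\le\mathcal F(\nu,\xi)$ for all $\nu\in\mathcal M$ and strict inequality for at least one $\nu\in\mathcal M$.
   Context: Notation: $x_{1:n}=x_1\ldots x_n$, $x_{<t}=x_1\ldots x_{t-1}$. A probability distribution $\rho$ on sequences is given by $\rho(x_{1:n})$, the probability that an infinite sequence starts with $x_{1:n}$. Conditional probabilities are $\rho(x_t|x_{<t})=\rho(x_{1:t})/\rho(x_{<t})$ (defined as $0$ if $\rho(x_{<t})=0$). Let $\mathcal Y$ be an action space and $\ell_{xy}\in[0,1]$ ($x\in\mathcal X,y\in\mathcal Y$) a loss function. $\Lambda_\rho$ is the scheme choosing $y_t^{\Lambda_\rho}\in\arg\min_{y_t\in\mathcal Y}\sum_{x_t}\rho(x_t|x_{<t})\ell_{x_ty_t}$ (a minimizer is assumed to exist; ties are broken arbitrarily), and $\Theta_\rho$ is the predictor choosing $x_t^{\Theta_\rho}\in\arg\max_{x_t\in\mathcal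 X}\rho(x_t|x_{<t})$. The performance measures $\mathcal F(\nu,\rho)$ of $\rho$ relative to $\nu$ are: - $s_t=\sum_{x_t}\big(\nu(x_t|x_{<t})-\rho(x_t|x_{<t})\big)^2$; - $d_t=\sum_{x_t}\nu(x_t|x_{<t})\ln\frac{\nu(x_t|x_{<t})}{\rho(x_t|x_{<t})}$ (value in $[0,\infty]$, with $0\ln 0=0$, equal to $+\infty$ if some $\rho(x_t|x_{<t})=0<\nu(x_t|x_{<t})$); - $e_t=1-\nu(x_t^{\Theta_\rho}|x_{<t})$; - $l_t=\sum_{x_t}\nu(x_t|x_{<t})\,\ell_{x_ty_t^{\Lambda_\rho}}$; - the totals $S_n,D_n,E_n,L_n$, each equal to $\sum_{t=1}^n\sum_{x_{<t}}\nu(x_{<t})\,f_t(x_{<t})$ with $f_t=s_t,d_t,e_t,l_t$ respectively. The instantaneous measures are considered for a fixed time $t$ and fixed history $x_{<t}$ (with $\xi(x_{<t})>0$); $\mathcal F(\nu,\cdot)$ is then regarded as existing only for those $\nu\in\mathcal M$ with $\nu(x_{<t})>0$, and the comparison runs over those $\nu$. *)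

theory Defs
  imports "HOL-Probability.Probability"
begin

definition seq_dists :: "'x::finite stream measure set" where
  "seq_dists = space (prob_algebra (stream_space (count_space UNIV)))"

definition cylinder :: "'x list \<Rightarrow> 'x stream set" where
  "cylinder xs = {\<omega>. stake (length xs) \<omega> = xs}"

definition prefix_prob :: "'x stream measure \<Rightarrow> 'x list \<Rightarrow> real" where
  "prefix_prob \<rho> xs = measure \<rho> (cylinder xs)"

text \<open>The history \<open>x\<^sub>1 \<dots> x\<^sub>t\<^sub>-\<^sub>1\<close> is a list \<open>h\<close>, so the time is \<open>t = length h + 1\<close>.
  Since \<open>a / 0 = 0\<close>, the conditional probability is \<open>0\<close> whenever the history has
  probability \<open>0\<close>.\<close>

definition cond_prob :: "'x stream measure \<Rightarrow> 'x list \<Rightarrow> 'x \<Rightarrow> real" where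
  "cond_prob \<rho> h x = prefix_prob \<rho> (h @ [x]) / prefix_prob \<rho> h"

text \<open>The integral over the counting measure on \<open>M\<close> is the sum
  \<open>\<Sum>\<nu>\<in>M. w \<nu> * \<nu> A\<close>; the lemmas below show that it is countably additive in \<open>A\<close>, so
  that the \<open>measure_of\<close> does not degenerate, and that the total mass is \<open>1\<close>.\<close>

definition mixture ::
    "'x::finite stream measure set \<Rightarrow> ('x stream measure \<Rightarrow> real) \<Rightarrow> 'x stream measure" where
  "mixture M w = measure_of UNIV (sets (stream_space (count_space UNIV)))
     (\<lambda>A. \<integral>\<^sup>+ \<nu>. ennreal (w \<nu>) * emeasure \<nu> A \<partial>count_space M)"

lemma space_stream_UNIV: "space (stream_space (count_space UNIV)) = UNIV"
  by (simp add: space_stream_space)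

lemma sets_mixture [simp]: "sets (mixture M w) = sets (stream_space (count_space UNIV))"
  unfolding mixture_def
  by (metis sets.sets_measure_of_eq space_stream_UNIV)

lemma emeasure_mixture:
  assumes M: "M \<subseteq> seq_dists" and A: "A \<in> sets (stream_space (count_space UNIV))"
  shows "emeasure (mixture M w) A = (\<integral>\<^sup>+ \<nu>. ennreal (w \<nu>) * emeasure \<nu> A \<partial>count_space M)"
proof (rule emeasure_measure_of[OF mixture_def])
  show "sets (stream_space (count_space UNIV)) \<subseteq> Pow UNIV" by simp
  show "A \<in> sets (mixture M w)" using A by simp
  show "positive (sets (mixture M w)) (\<lambda>A. \<integral>\<^sup>+ \<nu>. ennreal (w \<nu>) * emeasure \<nu> A \<partial>count_space M)"
    by (simp add: positive_def)
  show "countably_additive (sets (mixture M w))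
      (\<lambda>A. \<integral>\<^sup>+ \<nu>. ennreal (w \<nu>) * emeasure \<nu> A \<partial>count_space M)"
  proof (rule countably_additiveI)
    fix B :: "nat \<Rightarrow> 'a stream set"
    assume B: "range B \<subseteq> sets (mixture M w)" "disjoint_family B"
    have *: "(\<Sum>i. emeasure \<nu> (B i)) = emeasure \<nu> (\<Union>i. B i)"
      if "\<nu> \<in> M" for \<nu>
    proof -
      have "sets \<nu> = sets (mixture M w)"
        using that M by (auto simp: seq_dists_def space_prob_algebra)
      then show ?thesis using B by (intro suminf_emeasure) simp_all
    qed
    show "(\<Sum>i. \<integral>\<^sup>+ \<nu>. ennreal (w \<nu>) * emeasure \<nu> (B i) \<partial>count_space M)
        = (\<integral>\<^sup>+ \<nu>. ennreal (w \<nu>) * emeasure \<nu> (\<Union>i. B i) \<partial>count_space M)"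
      by (subst nn_integral_suminf[symmetric]) (auto intro!: nn_integral_cong simp: *)
  qed
qed

lemma mixture_in_seq_dists:
  assumes M: "M \<subseteq> seq_dists" and w: "\<And>\<nu>. \<nu> \<in> M \<Longrightarrow> 0 < w \<nu>" and sum: "(w has_sum 1) M"
  shows "mixture M w \<in> seq_dists"
proof -
  have sp: "space (mixture M w) = UNIV"
    by (simp add: mixture_def space_measure_of_conv)
  have UNIV_sets: "UNIV \<in> sets (stream_space (count_space (UNIV :: 'a set)))"
    by (metis sets.top space_stream_UNIV)
  have one: "emeasure \<nu> UNIV = 1" if "\<nu> \<in> M" for \<nu>
    using that M in_space_prob_algebra[of \<nu> "stream_space (count_space UNIV)"]
    by (auto simp: seq_dists_def space_stream_UNIV)
  have abs: "Infinite_Set_Sum.abs_summable_on w M"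
    using has_sum_imp_summable[OF sum] abs_summable_equivalent[of w M]
      summable_on_iff_abs_summable_on_real[of w M] by blast
  have "emeasure (mixture M w) UNIV = (\<integral>\<^sup>+ \<nu>. ennreal (w \<nu>) \<partial>count_space M)"
    by (subst emeasure_mixture[OF M UNIV_sets]) (auto intro!: nn_integral_cong simp: one)
  also have "\<dots> = ennreal (infsetsum w M)"
    using abs w by (intro nn_integral_conv_infsetsum) (auto simp: less_imp_le)
  also have "infsetsum w M = 1"
    using abs sum by (metis infsetsum_infsum infsumI)
  finally have "prob_space (mixture M w)"
    by (intro prob_spaceI) (simp add: sp)
  then show ?thesis by (simp add: seq_dists_def space_prob_algebra)
qed

text \<open>A scheme \<open>\<Lambda>\<close> (or \<open>\<Theta>\<close>) assigns a minimizing action (or most likely symbol) to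
  each distribution and history; a specific \<open>\<Lambda>\<close> or \<open>\<Theta>\<close> fixes the way ties are broken.\<close>

definition action_scheme ::
    "('x::finite \<Rightarrow> 'y \<Rightarrow> real) \<Rightarrow> ('x stream measure \<Rightarrow> 'x list \<Rightarrow> 'y) \<Rightarrow> bool" where
  "action_scheme loss \<Lambda> \<longleftrightarrow>
     (\<forall>\<rho>\<in>seq_dists. \<forall>h. is_arg_min (\<lambda>y. \<Sum>x\<in>UNIV. cond_prob \<rho> h x * loss x y) (\<lambda>_. True) (\<Lambda> \<rho> h))"

definition prediction_scheme :: "('x::finite stream measure \<Rightarrow> 'x list \<Rightarrow> 'x) \<Rightarrow> bool" where
  "prediction_scheme \<Theta> \<longleftrightarrow>
     (\<forall>\<rho>\<in>seq_dists. \<forall>h. is_arg_max (\<lambda>x. cond_prob \<rho> h x) (\<lambda>_. True) (\<Theta> \<rho> h))"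

definition sq_dist ::
    "'x::finite list \<Rightarrow> 'x stream measure \<Rightarrow> 'x stream measure \<Rightarrow> ereal" where
  "sq_dist h \<nu> \<rho> = ereal (\<Sum>x\<in>UNIV. (cond_prob \<nu> h x - cond_prob \<rho> h x)\<^sup>2)"

text \<open>Summands with \<open>cond_prob \<nu> h x = 0\<close> vanish, because \<open>0 * a = 0\<close> for every \<open>a\<close>.\<close>

definition entropy_dist ::
    "'x::finite list \<Rightarrow> 'x stream measure \<Rightarrow> 'x stream measure \<Rightarrow> ereal" where
  "entropy_dist h \<nu> \<rho> =
     (if \<exists>x. cond_prob \<rho> h x = 0 \<and> 0 < cond_prob \<nu> h x then \<infinity>
      else ereal (\<Sum>x\<in>UNIV. cond_prob \<nu> h x * ln (cond_prob \<nu> h x / cond_prob \<rho> h x)))"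

definition expected_error :: "('x::finite stream measure \<Rightarrow> 'x list \<Rightarrow> 'x) \<Rightarrow>
    'x list \<Rightarrow> 'x stream measure \<Rightarrow> 'x stream measure \<Rightarrow> ereal" where
  "expected_error \<Theta> h \<nu> \<rho> = ereal (1 - cond_prob \<nu> h (\<Theta> \<rho> h))"

definition expected_loss :: "('x::finite \<Rightarrow> 'y \<Rightarrow> real) \<Rightarrow> ('x stream measure \<Rightarrow> 'x list \<Rightarrow> 'y) \<Rightarrow>
    'x list \<Rightarrow> 'x stream measure \<Rightarrow> 'x stream measure \<Rightarrow> ereal" where
  "expected_loss loss \<Lambda> h \<nu> \<rho> = ereal (\<Sum>x\<in>UNIV. cond_prob \<nu> h x * loss x (\<Lambda> \<rho> h))"

text \<open>In \<^typ>\<open>ereal\<close>, \<open>0 * \<infinity> = 0\<close>: histories of \<open>\<nu>\<close>-probability \<open>0\<close> do not contribute.\<close>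

definition cumulative :: "('x::finite list \<Rightarrow> 'x stream measure \<Rightarrow> 'x stream measure \<Rightarrow> ereal) \<Rightarrow>
    nat \<Rightarrow> 'x stream measure \<Rightarrow> 'x stream measure \<Rightarrow> ereal" where
  "cumulative f n \<nu> \<rho> =
     (\<Sum>t = 1..n. \<Sum>h | length h = t - 1. ereal (prefix_prob \<nu> h) * f h \<nu> \<rho>)"

definition pareto_optimal :: "'x::finite stream measure set \<Rightarrow>
    ('x stream measure \<Rightarrow> 'x stream measure \<Rightarrow> ereal) \<Rightarrow> 'x stream measure \<Rightarrow> bool" where
  "pareto_optimal M F \<xi> \<longleftrightarrow>
     \<not> (\<exists>\<rho>\<in>seq_dists. (\<forall>\<nu>\<in>M. F \<nu> \<rho> \<le> F \<nu> \<xi>) \<and> (\<exists>\<nu>\<in>M. F \<nu> \<rho> < F \<nu> \<xi>))"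

text \<open>An instantaneous measure at history \<open>h\<close> only compares those \<open>\<nu>\<close> that give \<open>h\<close>
  positive probability.\<close>

definition pareto_optimal_at :: "'x::finite list \<Rightarrow> 'x stream measure set \<Rightarrow>
    ('x list \<Rightarrow> 'x stream measure \<Rightarrow> 'x stream measure \<Rightarrow> ereal) \<Rightarrow> 'x stream measure \<Rightarrow> bool" where
  "pareto_optimal_at h M f \<xi> \<longleftrightarrow> pareto_optimal {\<nu>\<in>M. 0 < prefix_prob \<nu> h} (f h) \<xi>"

end

theory Submission
  imports Defs
begin

text \<open>Compare \<open>\<xi>\<close> with a competitor \<open>\<rho>\<close> at a history \<open>h\<close>. For each of the four measures the
  difference \<open>f(\<nu>,\<xi>) - f(\<nu>,\<rho>)\<close> is linear in the conditional probabilities of \<open>\<nu>\<close>: the terms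
  that are nonlinear in \<open>\<nu>\<close> do not depend on the second argument and cancel. Multiplied by \<open>\<nu>(h)\<close>
  it is linear in \<open>\<nu>\<close> itself, so averaging it with the weights \<open>w\<^sub>\<nu>\<close> replaces \<open>\<nu>\<close> by \<open>\<xi>\<close>. Since
  \<open>f(\<xi>,\<sqdot>)\<close> is minimal at \<open>\<xi>\<close>, the average is at most \<open>0\<close>, whereas a Pareto improvement
  would make every term nonnegative and one term positive.\<close>

section \<open>Cylinders and the chain rule for prefix probabilities\<close>

lemma cylinder_in_sets: "cylinder xs \<in> sets (stream_space (count_space (UNIV :: 'x::finite set)))"
proof -
  have "cylinder xs = {\<omega> \<in> space (stream_space (count_space UNIV)). stake (length xs) \<omega> = xs}"
    by (auto simp: cylinder_def space_stream_UNIV)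
  also have "\<dots> \<in> sets (stream_space (count_space UNIV))"
    by measurable
  finally show ?thesis .
qed

lemma cylinder_snoc: "cylinder xs = (\<Union>x. cylinder (xs @ [x]))"
  by (auto simp: cylinder_def stake_Suc simp del: stake.simps(2))

lemma disjoint_cylinder_snoc: "disjoint_family (\<lambda>x. cylinder (xs @ [x]))"
  by (auto simp: disjoint_family_on_def cylinder_def stake_Suc simp del: stake.simps(2))

lemma prefix_prob_nonneg [simp]: "0 \<le> prefix_prob \<nu> h"
  by (simp add: prefix_prob_def)

lemma prefix_prob_pos_iff [simp]: "0 < prefix_prob \<nu> h \<longleftrightarrow> prefix_prob \<nu> h \<noteq> 0"
  by (simp add: less_le)

lemma cond_prob_nonneg [simp]: "0 \<le> cond_prob \<nu> h x"
  by (simp add: cond_prob_def)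

lemma cond_prob_pos_iff [simp]: "0 < cond_prob \<nu> h x \<longleftrightarrow> cond_prob \<nu> h x \<noteq> 0"
  by (simp add: less_le)

lemma seq_distsD:
  assumes "\<nu> \<in> seq_dists"
  shows "prob_space \<nu>" and "sets \<nu> = sets (stream_space (count_space UNIV))"
  using assms by (auto simp: seq_dists_def space_prob_algebra)

lemma sum_prefix_prob_snoc:
  assumes "\<nu> \<in> seq_dists"
  shows "(\<Sum>x\<in>UNIV. prefix_prob \<nu> (h @ [x])) = prefix_prob \<nu> h"
proof -
  interpret prob_space \<nu> using assms by (rule seq_distsD)
  show ?thesis
    unfolding prefix_prob_def cylinder_snoc[of h]
    by (rule finite_measure_finite_Union[symmetric])
       (use seq_distsD(2)[OF assms] cylinder_in_sets disjoint_cylinder_snoc in auto)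
qed

text \<open>Extensions of a null history are null as well, so the chain rule survives the convention
  \<open>a / 0 = 0\<close>.\<close>

lemma prefix_prob_snoc:
  assumes "\<nu> \<in> seq_dists"
  shows "prefix_prob \<nu> (h @ [x]) = prefix_prob \<nu> h * cond_prob \<nu> h x"
proof (cases "prefix_prob \<nu> h = 0")
  case True
  then have "(\<Sum>x\<in>UNIV. prefix_prob \<nu> (h @ [x])) = 0"
    using sum_prefix_prob_snoc[OF assms] by metis
  then show ?thesis
    using True by (simp add: sum_nonneg_eq_0_iff)
qed (simp add: cond_prob_def)

lemma sum_cond_prob:
  assumes "\<nu> \<in> seq_dists"
  shows "(\<Sum>x\<in>UNIV. cond_prob \<nu> h x) = of_bool (0 < prefix_prob \<nu> h)"
  using sum_prefix_prob_snoc[OF assms, of h] prefix_prob_nonneg[of \<nu> h]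
  by (auto simp: cond_prob_def simp flip: sum_divide_distrib)

lemma finite_lists_length [simp]: "finite {h :: 'x::finite list. length h = n}"
  using finite_lists_length_eq[of "UNIV :: 'x set" n] by simp

lemma has_sum_sum_finite:
  fixes f :: "'i \<Rightarrow> 'a \<Rightarrow> 'b::topological_comm_monoid_add"
  assumes "finite I" "\<And>i. i \<in> I \<Longrightarrow> (f i has_sum s i) A"
  shows "((\<lambda>a. \<Sum>i\<in>I. f i a) has_sum (\<Sum>i\<in>I. s i)) A"
  using assms by (induction I rule: finite_induct) (auto intro: has_sum_add)

section \<open>The mixture as a weighted sum of prefix probabilities\<close>

locale bayes_mixture =
  fixes M :: "'x::finite stream measure set"
    and w :: "'x stream measure \<Rightarrow> real"
    and \<xi> :: "'x stream measure"
  assumes M: "M \<subseteq> seq_dists"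
    and w_pos: "\<And>\<nu>. \<nu> \<in> M \<Longrightarrow> 0 < w \<nu>"
    and w_sum: "(w has_sum 1) M"
    and \<xi>: "\<xi> = mixture M w"
begin

lemma xi_in_seq_dists: "\<xi> \<in> seq_dists"
  unfolding \<xi> using M w_pos w_sum by (rule mixture_in_seq_dists)

text \<open>The terms are dominated by the summable weights \<open>w\<close>, so the integral that
  defines the mixture becomes a convergent real sum, on which the averaging rests.\<close>

lemma prefix_prob_mixture: "((\<lambda>\<nu>. w \<nu> * prefix_prob \<nu> h) has_sum prefix_prob \<xi> h) M"
proof -
  have le: "w \<nu> * prefix_prob \<nu> h \<le> w \<nu>" if "\<nu> \<in> M" for \<nu>
    using that M w_pos[OF that] prob_space.prob_le_1[of \<nu>]
    by (auto simp: prefix_prob_def seq_distsD intro!: mult_left_le)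
  have nonneg: "0 \<le> w \<nu> * prefix_prob \<nu> h" if "\<nu> \<in> M" for \<nu>
    using w_pos[OF that] by simp
  have summable: "(\<lambda>\<nu>. w \<nu> * prefix_prob \<nu> h) summable_on M"
    using has_sum_imp_summable[OF w_sum] le nonneg by (rule summable_on_comparison_test)
  then have abs: "Infinite_Set_Sum.abs_summable_on (\<lambda>\<nu>. w \<nu> * prefix_prob \<nu> h) M"
    using abs_summable_equivalent[of "\<lambda>\<nu>. w \<nu> * prefix_prob \<nu> h" M]
      summable_on_iff_abs_summable_on_real[of "\<lambda>\<nu>. w \<nu> * prefix_prob \<nu> h" M] by blast
  have "emeasure \<xi> (cylinder h)
      = (\<integral>\<^sup>+ \<nu>. ennreal (w \<nu>) * emeasure \<nu> (cylinder h) \<partial>count_space M)"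
    unfolding \<xi> using M cylinder_in_sets by (rule emeasure_mixture)
  also have "\<dots> = (\<integral>\<^sup>+ \<nu>. ennreal (w \<nu> * prefix_prob \<nu> h) \<partial>count_space M)"
  proof (rule nn_integral_cong)
    fix \<nu> assume "\<nu> \<in> space (count_space M)"
    then have "\<nu> \<in> M" by simp
    then interpret prob_space \<nu> using M by (auto intro: seq_distsD)
    show "ennreal (w \<nu>) * emeasure \<nu> (cylinder h) = ennreal (w \<nu> * prefix_prob \<nu> h)"
      using w_pos[OF \<open>\<nu> \<in> M\<close>]
      by (simp add: emeasure_eq_measure prefix_prob_def ennreal_mult)
  qed
  also have "\<dots> = ennreal (\<Sum>\<^sub>\<infinity>\<nu>\<in>M. w \<nu> * prefix_prob \<nu> h)"
    using abs nonneg infsetsum_infsum[OF abs] by (simp add: nn_integral_conv_infsetsum)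
  finally have "prefix_prob \<xi> h = (\<Sum>\<^sub>\<infinity>\<nu>\<in>M. w \<nu> * prefix_prob \<nu> h)"
    using nonneg by (simp add: prefix_prob_def measure_def infsum_nonneg)
  then show ?thesis
    using summable by simp
qed

text \<open>Joint probabilities are essential here: \<xi>(x|h) is in general not the
  \<open>w\<close>-average of the \<nu>(x|h), since conditioning replaces the weights by posterior
  ones.\<close>

lemma prefix_prob_mixture_linear:
  "((\<lambda>\<nu>. w \<nu> * (\<Sum>x\<in>UNIV. prefix_prob \<nu> (h @ [x]) * c x))
     has_sum (\<Sum>x\<in>UNIV. prefix_prob \<xi> (h @ [x]) * c x)) M"
  by (simp add: sum_distrib_left mult.assoc[symmetric])
     (intro has_sum_sum_finite has_sum_cmult_left prefix_prob_mixture finite)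

lemma prefix_prob_mixture_eq_0_iff: "prefix_prob \<xi> h = 0 \<longleftrightarrow> (\<forall>\<nu>\<in>M. prefix_prob \<nu> h = 0)"
proof
  assume zero: "prefix_prob \<xi> h = 0"
  show "\<forall>\<nu>\<in>M. prefix_prob \<nu> h = 0"
  proof
    fix \<nu> assume \<nu>: "\<nu> \<in> M"
    have "w \<nu> * prefix_prob \<nu> h = 0"
      by (rule nonneg_has_sum_le_0D[OF prefix_prob_mixture[of h]])
         (use zero \<nu> w_pos in \<open>simp_all add: less_imp_le\<close>)
    then show "prefix_prob \<nu> h = 0"
      using w_pos[OF \<nu>] by simp
  qed
next
  assume "\<forall>\<nu>\<in>M. prefix_prob \<nu> h = 0"
  then have "((\<lambda>\<nu>. w \<nu> * prefix_prob \<nu> h) has_sum 0) M"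
    by (intro has_sum_0) simp
  then show "prefix_prob \<xi> h = 0"
    using prefix_prob_mixture[of h] has_sum_unique by metis
qed

text \<open>Positive weights exclude cancellation, so what is null under \<xi> is null under every
  \<nu> in \<open>M\<close>. This keeps the divergence of \<nu> from \<xi> finite.\<close>

lemma cond_prob_mixture_eq_0:
  assumes "\<nu> \<in> M" "cond_prob \<xi> h x = 0"
  shows "cond_prob \<nu> h x = 0"
  using assms prefix_prob_mixture_eq_0_iff[of h] prefix_prob_mixture_eq_0_iff[of "h @ [x]"]
  by (auto simp: cond_prob_def)

section \<open>From linear regret to Pareto optimality\<close>

text \<open>The averaging argument, with \<open>G\<close> the regret of \<xi> against a competitor:
  nonnegative terms with positive weights and a total of at most \<open>0\<close> all
  vanish.\<close>

lemma weighted_sum_no_improvement: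
  assumes "((\<lambda>\<nu>. w \<nu> * G \<nu>) has_sum s) M" and "s \<le> (0 :: real)"
    and "\<And>\<nu>. \<nu> \<in> M \<Longrightarrow> 0 \<le> G \<nu>"
    and \<nu>: "\<nu> \<in> M"
  shows "G \<nu> = 0"
proof -
  have "w \<nu> * G \<nu> = 0"
    by (rule nonneg_has_sum_le_0D[OF assms(1,2)])
       (use assms w_pos in \<open>simp_all add: less_imp_le\<close>)
  then show ?thesis
    using w_pos[OF \<nu>] by simp
qed

text \<open>The coefficients \<open>c\<close> must not depend on \<open>\<nu>\<close>. They are only demanded for competitors of finite
  divergence, because for \<^const>\<open>entropy_dist\<close> they are \<open>ln (\<rho>(x|h) / \<xi>(x|h))\<close>; an infinite
  divergence rules out a Pareto improvement anyway.\<close>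

definition linear_regret ::
    "('x list \<Rightarrow> 'x stream measure \<Rightarrow> 'x stream measure \<Rightarrow> ereal) \<Rightarrow> bool" where
  "linear_regret f \<longleftrightarrow> (\<forall>h. \<forall>\<rho>\<in>seq_dists.
     (\<forall>\<nu>\<in>M. 0 < prefix_prob \<nu> h \<longrightarrow> \<bar>f h \<nu> \<xi>\<bar> \<noteq> \<infinity> \<and> f h \<nu> \<rho> \<noteq> -\<infinity>) \<and>
     (0 < prefix_prob \<xi> h \<and> (\<forall>\<nu>\<in>M. 0 < prefix_prob \<nu> h \<longrightarrow> f h \<nu> \<rho> \<noteq> \<infinity>) \<longrightarrow>
       (\<exists>c. (\<forall>\<nu>\<in>M. 0 < prefix_prob \<nu> h \<longrightarrow>
               f h \<nu> \<xi> = f h \<nu> \<rho> + ereal (\<Sum>x\<in>UNIV. cond_prob \<nu> h x * c x)) \<and>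
            (\<Sum>x\<in>UNIV. cond_prob \<xi> h x * c x) \<le> 0)))"

lemma linear_regret_finite:
  assumes "linear_regret f" "\<rho> \<in> seq_dists" "\<nu> \<in> M" "0 < prefix_prob \<nu> h"
  shows "\<bar>f h \<nu> \<xi>\<bar> \<noteq> \<infinity>" and "f h \<nu> \<rho> \<noteq> -\<infinity>"
  using assms by (simp_all add: linear_regret_def)

text \<open>Multiplying by the prefix probability clears the denominators and extends the identity
  to null histories, where all terms are \<open>0\<close>. If \<open>h\<close> is null under \<xi>,
  it is null under every member of \<open>M\<close>, and zero coefficients serve.\<close>

lemma linear_regretD:
  assumes f: "linear_regret f" and \<rho>: "\<rho> \<in> seq_dists"
    and fin: "\<And>\<nu>. \<nu> \<in> M \<Longrightarrow> 0 < prefix_prob \<nu> h \<Longrightarrow> f h \<nu> \<rho> \<noteq> \<infinity>"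
  shows "\<exists>c. (\<forall>\<nu>\<in>M. ereal (prefix_prob \<nu> h) * f h \<nu> \<xi>
        = ereal (prefix_prob \<nu> h) * f h \<nu> \<rho> + ereal (\<Sum>x\<in>UNIV. prefix_prob \<nu> (h @ [x]) * c x)) \<and>
      (\<Sum>x\<in>UNIV. prefix_prob \<xi> (h @ [x]) * c x) \<le> 0"
proof (cases "0 < prefix_prob \<xi> h")
  case True
  have "\<exists>c. (\<forall>\<nu>\<in>M. 0 < prefix_prob \<nu> h \<longrightarrow>
               f h \<nu> \<xi> = f h \<nu> \<rho> + ereal (\<Sum>x\<in>UNIV. cond_prob \<nu> h x * c x)) \<and>
            (\<Sum>x\<in>UNIV. cond_prob \<xi> h x * c x) \<le> 0"
    using f[unfolded linear_regret_def, rule_format, OF \<rho>] True fin by blast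
  then obtain c where
    c: "\<And>\<nu>. \<nu> \<in> M \<Longrightarrow> 0 < prefix_prob \<nu> h \<Longrightarrow>
          f h \<nu> \<xi> = f h \<nu> \<rho> + ereal (\<Sum>x\<in>UNIV. cond_prob \<nu> h x * c x)"
      and le: "(\<Sum>x\<in>UNIV. cond_prob \<xi> h x * c x) \<le> 0"
    by blast
  show ?thesis
  proof (intro exI conjI ballI)
    fix \<nu> assume \<nu>: "\<nu> \<in> M"
    have snoc: "(\<Sum>x\<in>UNIV. prefix_prob \<nu> (h @ [x]) * c x)
        = prefix_prob \<nu> h * (\<Sum>x\<in>UNIV. cond_prob \<nu> h x * c x)"
      using \<nu> M by (subst prefix_prob_snoc) (auto simp: sum_distrib_left mult.assoc)
    show "ereal (prefix_prob \<nu> h) * f h \<nu> \<xi>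
        = ereal (prefix_prob \<nu> h) * f h \<nu> \<rho> + ereal (\<Sum>x\<in>UNIV. prefix_prob \<nu> (h @ [x]) * c x)"
    proof (cases "0 < prefix_prob \<nu> h")
      case True
      then show ?thesis
        unfolding snoc c[OF \<nu> True] by (simp add: ereal_distrib_left)
    next
      case False
      then show ?thesis
        unfolding snoc by (simp flip: zero_ereal_def)
    qed
  next
    have "(\<Sum>x\<in>UNIV. prefix_prob \<xi> (h @ [x]) * c x)
        = prefix_prob \<xi> h * (\<Sum>x\<in>UNIV. cond_prob \<xi> h x * c x)"
      using xi_in_seq_dists by (subst prefix_prob_snoc) (auto simp: sum_distrib_left mult.assoc)
    then show "(\<Sum>x\<in>UNIV. prefix_prob \<xi> (h @ [x]) * c x) \<le> 0"
      using le by (simp add: mult_nonneg_nonpos)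
  qed
next
  case False
  then have "prefix_prob \<nu> h = 0" if "\<nu> \<in> M" for \<nu>
    using that prefix_prob_mixture_eq_0_iff[of h] by simp
  then show ?thesis
    by (intro exI[of _ "\<lambda>_. 0"]) (auto simp flip: zero_ereal_def)
qed

lemma linear_regret_imp_pareto_optimal_at:
  assumes f: "linear_regret f"
  shows "pareto_optimal_at h M f \<xi>"
  unfolding pareto_optimal_at_def pareto_optimal_def
proof (rule notI, clarify)
  fix \<rho> \<nu>
  assume \<rho>: "\<rho> \<in> seq_dists"
    and le: "\<forall>\<nu>\<in>{\<nu>\<in>M. 0 < prefix_prob \<nu> h}. f h \<nu> \<rho> \<le> f h \<nu> \<xi>"
    and \<nu>: "\<nu> \<in> M" "0 < prefix_prob \<nu> h" and less: "f h \<nu> \<rho> < f h \<nu> \<xi>"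
  \<comment> \<open>A Pareto improvement bounds the value of \<rho> by the finite value of \<xi>, so
    the regret is a real number.\<close>
  have fin: "\<bar>f h \<mu> \<xi>\<bar> \<noteq> \<infinity> \<and> f h \<mu> \<rho> \<noteq> -\<infinity> \<and> f h \<mu> \<rho> \<noteq> \<infinity>"
    if "\<mu> \<in> M" "0 < prefix_prob \<mu> h" for \<mu>
    using linear_regret_finite[OF f \<rho> that] le[rule_format, of \<mu>] that by auto
  obtain c where
    c: "\<And>\<mu>. \<mu> \<in> M \<Longrightarrow>
          ereal (prefix_prob \<mu> h) * f h \<mu> \<xi>
            = ereal (prefix_prob \<mu> h) * f h \<mu> \<rho> + ereal (\<Sum>x\<in>UNIV. prefix_prob \<mu> (h @ [x]) * c x)"
      and nonpos: "(\<Sum>x\<in>UNIV. prefix_prob \<xi> (h @ [x]) * c x) \<le> 0"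
    using linear_regretD[OF f \<rho>, of h] fin by blast
  define G where "G \<mu> = (\<Sum>x\<in>UNIV. prefix_prob \<mu> (h @ [x]) * c x)" for \<mu>
  have G: "G \<mu> = prefix_prob \<mu> h * (real_of_ereal (f h \<mu> \<xi>) - real_of_ereal (f h \<mu> \<rho>))"
    if "\<mu> \<in> M" "0 < prefix_prob \<mu> h" for \<mu>
    using c[OF that(1)] fin[OF that]
    by (cases "f h \<mu> \<xi>"; cases "f h \<mu> \<rho>") (auto simp: G_def algebra_simps)
  \<comment> \<open>The average runs over all of \<open>M\<close>, hence also over measures excluded
    from the comparison; for these \<open>h\<close> is null and \<open>G\<close> is
    \<open>0\<close>.\<close>
  have "0 \<le> G \<mu>" if "\<mu> \<in> M" for \<mu>
  proof (cases "0 < prefix_prob \<mu> h")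
    case True
    then show ?thesis
      using le[rule_format, of \<mu>] fin[OF that True] that
      by (cases "f h \<mu> \<xi>"; cases "f h \<mu> \<rho>") (auto simp: G)
  next
    case False
    then show ?thesis
      using that M by (auto simp: G_def prefix_prob_snoc subset_iff)
  qed
  then have "G \<nu> = 0"
    using weighted_sum_no_improvement[of G] prefix_prob_mixture_linear[of h c] nonpos \<nu>
    unfolding G_def by blast
  moreover have "0 < G \<nu>"
    using less \<nu> fin[OF \<nu>]
    by (cases "f h \<nu> \<xi>"; cases "f h \<nu> \<rho>") (auto simp: G)
  ultimately show False by simp
qed

text \<open>For a given \<nu> the regrets at single histories may have either sign; an improvement
  only makes their total \<open>G\<close> nonnegative. The averaging argument is therefore applied
  to the total, whose value at \<xi> is a sum of nonpositive contributions.\<close>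

lemma linear_regret_imp_pareto_optimal_cumulative:
  assumes f: "linear_regret f"
  shows "pareto_optimal M (cumulative f n) \<xi>"
  unfolding pareto_optimal_def
proof (rule notI, clarify)
  fix \<rho> \<nu>
  assume \<rho>: "\<rho> \<in> seq_dists"
    and le: "\<forall>\<nu>\<in>M. cumulative f n \<nu> \<rho> \<le> cumulative f n \<nu> \<xi>"
    and \<nu>: "\<nu> \<in> M" and less: "cumulative f n \<nu> \<rho> < cumulative f n \<nu> \<xi>"
  have term_xi: "\<bar>ereal (prefix_prob \<mu> h) * f h \<mu> \<xi>\<bar> \<noteq> \<infinity>" if "\<mu> \<in> M" for \<mu> h
    using linear_regret_finite[OF f \<rho> that, of h]
    by (cases "f h \<mu> \<xi>"; cases "prefix_prob \<mu> h = 0") (auto simp flip: zero_ereal_def)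
  have cum_xi: "\<bar>cumulative f n \<mu> \<xi>\<bar> \<noteq> \<infinity>" if "\<mu> \<in> M" for \<mu>
    unfolding cumulative_def using term_xi[OF that] by (auto simp: sum_Inf)
  have term_rho: "ereal (prefix_prob \<mu> h) * f h \<mu> \<rho> \<noteq> -\<infinity>" if "\<mu> \<in> M" for \<mu> h
    using linear_regret_finite[OF f \<rho> that, of h]
    by (cases "f h \<mu> \<rho>"; cases "prefix_prob \<mu> h = 0") (auto simp flip: zero_ereal_def)
  \<comment> \<open>One infinite term would make the total of \<rho> infinite, above the finite
    total of \<xi>.\<close>
  have fin: "f h \<mu> \<rho> \<noteq> \<infinity>"
    if "\<mu> \<in> M" "0 < prefix_prob \<mu> h" "t \<in> {1..n}" "length h = t - 1" for \<mu> h t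
  proof
    assume "f h \<mu> \<rho> = \<infinity>"
    then have "(\<Sum>h | length h = t - 1. ereal (prefix_prob \<mu> h) * f h \<mu> \<rho>) = \<infinity>"
      using that by (auto simp: sum_Pinfty intro!: exI[of _ h])
    then have "cumulative f n \<mu> \<rho> = \<infinity>"
      using that(3) unfolding cumulative_def by (auto simp: sum_Pinfty intro!: bexI[of _ t])
    then show False
      using le cum_xi \<open>\<mu> \<in> M\<close> by force
  qed
  define P where "P h c \<longleftrightarrow>
      (\<forall>\<mu>\<in>M. ereal (prefix_prob \<mu> h) * f h \<mu> \<xi>
        = ereal (prefix_prob \<mu> h) * f h \<mu> \<rho> + ereal (\<Sum>x\<in>UNIV. prefix_prob \<mu> (h @ [x]) * c x)) \<and>
      (\<Sum>x\<in>UNIV. prefix_prob \<xi> (h @ [x]) * c x) \<le> 0" for h c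
  \<comment> \<open>The coefficients depend on the history, so one family is chosen per
    \<open>h\<close>. The lengths below \<open>n\<close> are exactly the numbers
    \<open>t - 1\<close> with \<open>t\<close> in \<open>{1..n}\<close>.\<close>
  have "\<exists>c. P h c" if "length h < n" for h
  proof -
    have "f h \<mu> \<rho> \<noteq> \<infinity>" if "\<mu> \<in> M" "0 < prefix_prob \<mu> h" for \<mu>
      using fin[OF that, of "Suc (length h)"] \<open>length h < n\<close> by simp
    then show ?thesis
      unfolding P_def by (rule linear_regretD[OF f \<rho>])
  qed
  then have "\<forall>h\<in>{h. length h < n}. \<exists>c. P h c" by simp
  then have "\<exists>c. \<forall>h\<in>{h. length h < n}. P h (c h)" by (rule bchoice)
  then obtain c where P: "\<And>h. length h < n \<Longrightarrow> P h (c h)" by blast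
  have c: "ereal (prefix_prob \<mu> h) * f h \<mu> \<xi>
      = ereal (prefix_prob \<mu> h) * f h \<mu> \<rho> + ereal (\<Sum>x\<in>UNIV. prefix_prob \<mu> (h @ [x]) * c h x)"
    if "length h < n" "\<mu> \<in> M" for h \<mu>
    using P that by (simp add: P_def)
  have nonpos: "(\<Sum>x\<in>UNIV. prefix_prob \<xi> (h @ [x]) * c h x) \<le> 0" if "length h < n" for h
    using P that by (simp add: P_def)
  define G where
    "G \<mu> = (\<Sum>t = 1..n. \<Sum>h | length h = t - 1. \<Sum>x\<in>UNIV. prefix_prob \<mu> (h @ [x]) * c h x)" for \<mu>
  have G: "cumulative f n \<mu> \<xi> = cumulative f n \<mu> \<rho> + ereal (G \<mu>)" if "\<mu> \<in> M" for \<mu>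
  proof -
    have "cumulative f n \<mu> \<xi>
        = (\<Sum>t = 1..n. \<Sum>h | length h = t - 1. ereal (prefix_prob \<mu> h) * f h \<mu> \<rho>
              + ereal (\<Sum>x\<in>UNIV. prefix_prob \<mu> (h @ [x]) * c h x))"
      unfolding cumulative_def using that by (intro sum.cong refl c) auto
    then show ?thesis
      by (simp add: cumulative_def G_def sum.distrib del: sum_ereal flip: sum_ereal)
  qed
  have fin_diff: "\<bar>cumulative f n \<mu> \<rho>\<bar> \<noteq> \<infinity>" if "\<mu> \<in> M" for \<mu>
    using cum_xi[OF that] G[OF that] by (cases "cumulative f n \<mu> \<rho>") auto
  have "0 \<le> G \<mu>" if "\<mu> \<in> M" for \<mu>
    using le G[OF that] fin_diff[OF that] that by (cases "cumulative f n \<mu> \<rho>") force+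
  moreover have "((\<lambda>\<mu>. w \<mu> * G \<mu>) has_sum G \<xi>) M"
    \<comment> \<open>The weight is moved through the two outer sums only; the innermost sum then
      has the form of \<open>prefix_prob_mixture_linear\<close>.\<close>
    unfolding G_def sum_distrib_left[of "w _" _ "{1..n}"]
      sum_distrib_left[of "w _" _ "{h. length h = _}"]
    by (intro has_sum_sum_finite prefix_prob_mixture_linear finite_lists_length finite_atLeastAtMost)
  moreover have "G \<xi> \<le> 0"
    unfolding G_def by (intro sum_nonpos nonpos) auto
  ultimately have "G \<nu> = 0"
    using weighted_sum_no_improvement \<nu> by blast
  moreover have "0 < G \<nu>"
    using less G[OF \<nu>] fin_diff[OF \<nu>] by (cases "cumulative f n \<nu> \<rho>") auto
  ultimately show False by simp
qed

section \<open>Linear regret of the four measures\<close>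

lemma linear_regret_sq_dist: "linear_regret sq_dist"
proof -
  have "\<exists>c. (\<forall>\<nu>\<in>M. 0 < prefix_prob \<nu> h \<longrightarrow>
              sq_dist h \<nu> \<xi> = sq_dist h \<nu> \<rho> + ereal (\<Sum>x\<in>UNIV. cond_prob \<nu> h x * c x)) \<and>
            (\<Sum>x\<in>UNIV. cond_prob \<xi> h x * c x) \<le> 0"
    if "0 < prefix_prob \<xi> h" for h \<rho>
  proof -
    \<comment> \<open>Expanding the squares leaves a part \<open>K\<close> free of \<nu>. It can be
      added to every coefficient because the conditional probabilities of \<nu> sum to
      \<open>1\<close>.\<close>
    define K where "K = (\<Sum>x\<in>UNIV. (cond_prob \<xi> h x)\<^sup>2 - (cond_prob \<rho> h x)\<^sup>2)"
    define c where "c x = 2 * (cond_prob \<rho> h x - cond_prob \<xi> h x) + K" for x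
    \<comment> \<open>Stated on \<open>seq_dists\<close> so that it also applies to \<xi>, which may
      lie outside \<open>M\<close>.\<close>
    have lin: "(\<Sum>x\<in>UNIV. cond_prob \<nu> h x * c x)
        = (\<Sum>x\<in>UNIV. (cond_prob \<nu> h x - cond_prob \<xi> h x)\<^sup>2)
          - (\<Sum>x\<in>UNIV. (cond_prob \<nu> h x - cond_prob \<rho> h x)\<^sup>2)"
      if "\<nu> \<in> seq_dists" "0 < prefix_prob \<nu> h" for \<nu>
    proof -
      have "(\<Sum>x\<in>UNIV. cond_prob \<nu> h x * c x)
          = (\<Sum>x\<in>UNIV. 2 * cond_prob \<nu> h x * (cond_prob \<rho> h x - cond_prob \<xi> h x))
            + (\<Sum>x\<in>UNIV. cond_prob \<nu> h x) * K"
        by (simp add: c_def algebra_simps sum.distrib sum_subtractf sum_distrib_left)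
      also have "\<dots> = (\<Sum>x\<in>UNIV. 2 * cond_prob \<nu> h x * (cond_prob \<rho> h x - cond_prob \<xi> h x)) + K"
        using that by (simp add: sum_cond_prob)
      also have "\<dots> = (\<Sum>x\<in>UNIV. (cond_prob \<nu> h x - cond_prob \<xi> h x)\<^sup>2
                                - (cond_prob \<nu> h x - cond_prob \<rho> h x)\<^sup>2)"
        unfolding K_def sum.distrib[symmetric]
        by (intro sum.cong) (auto simp: power2_eq_square algebra_simps)
      finally show ?thesis by (simp add: sum_subtractf)
    qed
    \<comment> \<open>At \<nu> = \<xi> the first sum of squares vanishes, leaving minus the
      second.\<close>
    have "(\<Sum>x\<in>UNIV. cond_prob \<xi> h x * c x) \<le> 0"
      using lin[OF xi_in_seq_dists that] by (simp add: sum_nonneg)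
    then show ?thesis
      using lin M by (intro exI[of _ c]) (auto simp: sq_dist_def subset_iff)
  qed
  then show ?thesis
    unfolding linear_regret_def by (auto simp: sq_dist_def)
qed

text \<open>The action does not depend on \<nu>, so the loss is already linear in the conditional
  probabilities; nonpositivity at \<xi> is the minimality of the action chosen for \<xi>.\<close>

lemma linear_regret_expected_loss:
  assumes "action_scheme loss \<Lambda>"
  shows "linear_regret (expected_loss loss \<Lambda>)"
proof -
  have "\<exists>c. (\<forall>\<nu>\<in>M. 0 < prefix_prob \<nu> h \<longrightarrow>
              expected_loss loss \<Lambda> h \<nu> \<xi>
                = expected_loss loss \<Lambda> h \<nu> \<rho> + ereal (\<Sum>x\<in>UNIV. cond_prob \<nu> h x * c x)) \<and>
            (\<Sum>x\<in>UNIV. cond_prob \<xi> h x * c x) \<le> 0" for h \<rho>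
  proof -
    have "(\<Sum>x\<in>UNIV. cond_prob \<xi> h x * loss x (\<Lambda> \<xi> h))
        \<le> (\<Sum>x\<in>UNIV. cond_prob \<xi> h x * loss x (\<Lambda> \<rho> h))"
      using assms xi_in_seq_dists by (auto simp: action_scheme_def is_arg_min_linorder)
    then show ?thesis
      by (intro exI[of _ "\<lambda>x. loss x (\<Lambda> \<xi> h) - loss x (\<Lambda> \<rho> h)"])
         (simp add: expected_loss_def algebra_simps sum_subtractf)
  qed
  then show ?thesis
    unfolding linear_regret_def by (auto simp: expected_loss_def)
qed

lemma linear_regret_expected_error:
  assumes "prediction_scheme \<Theta>"
  shows "linear_regret (expected_error \<Theta>)"
proof -
  have "\<exists>c. (\<forall>\<nu>\<in>M. 0 < prefix_prob \<nu> h \<longrightarrow>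
              expected_error \<Theta> h \<nu> \<xi>
                = expected_error \<Theta> h \<nu> \<rho> + ereal (\<Sum>x\<in>UNIV. cond_prob \<nu> h x * c x)) \<and>
            (\<Sum>x\<in>UNIV. cond_prob \<xi> h x * c x) \<le> 0" for h \<rho>
  proof -
    \<comment> \<open>Difference of the 0-1 losses \<open>1 - of_bool (x = y)\<close> for the
      symbols \<open>y\<close> predicted by \<xi> and by \<rho>.\<close>
    define c where "c x = (of_bool (x = \<Theta> \<rho> h) - of_bool (x = \<Theta> \<xi> h) :: real)" for x
    have c: "(\<Sum>x\<in>UNIV. cond_prob \<nu> h x * c x) = cond_prob \<nu> h (\<Theta> \<rho> h) - cond_prob \<nu> h (\<Theta> \<xi> h)"
      for \<nu> by (simp add: c_def right_diff_distrib sum_subtractf)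
    have "cond_prob \<xi> h (\<Theta> \<rho> h) \<le> cond_prob \<xi> h (\<Theta> \<xi> h)"
      using assms xi_in_seq_dists by (auto simp: prediction_scheme_def is_arg_max_linorder)
    then show ?thesis
      by (intro exI[of _ c]) (simp add: expected_error_def c)
  qed
  then show ?thesis
    unfolding linear_regret_def by (auto simp: expected_error_def)
qed

text \<open>The logarithms of \<nu>(x|h) cancel in the difference; nonpositivity at \<xi> is Gibbs'
  inequality.\<close>

lemma linear_regret_entropy_dist: "linear_regret entropy_dist"
proof -
  have xi: "entropy_dist h \<nu> \<xi>
      = ereal (\<Sum>x\<in>UNIV. cond_prob \<nu> h x * ln (cond_prob \<nu> h x / cond_prob \<xi> h x))"
    if "\<nu> \<in> M" for h \<nu>
    using cond_prob_mixture_eq_0[OF that] by (auto simp: entropy_dist_def)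
  have "\<exists>c. (\<forall>\<nu>\<in>M. 0 < prefix_prob \<nu> h \<longrightarrow>
              entropy_dist h \<nu> \<xi>
                = entropy_dist h \<nu> \<rho> + ereal (\<Sum>x\<in>UNIV. cond_prob \<nu> h x * c x)) \<and>
            (\<Sum>x\<in>UNIV. cond_prob \<xi> h x * c x) \<le> 0"
    if \<rho>: "\<rho> \<in> seq_dists" and h: "0 < prefix_prob \<xi> h"
      and fin: "\<forall>\<nu>\<in>M. 0 < prefix_prob \<nu> h \<longrightarrow> entropy_dist h \<nu> \<rho> \<noteq> \<infinity>" for h \<rho>
  proof -
    define c where "c x = ln (cond_prob \<rho> h x / cond_prob \<xi> h x)" for x
    \<comment> \<open>A zero of \<rho> at a symbol possible under \<nu> would make the divergence
      infinite.\<close>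
    have rho_pos: "0 < cond_prob \<rho> h x" if "\<nu> \<in> M" "0 < cond_prob \<nu> h x" for \<nu> x
    proof -
      have "0 < prefix_prob \<nu> h"
        using that(2) by (auto simp: cond_prob_def)
      then show ?thesis
        using fin that by (auto simp: entropy_dist_def split: if_splits)
    qed
    have "entropy_dist h \<nu> \<xi>
        = entropy_dist h \<nu> \<rho> + ereal (\<Sum>x\<in>UNIV. cond_prob \<nu> h x * c x)"
      if \<nu>: "\<nu> \<in> M" for \<nu>
    proof -
      have "entropy_dist h \<nu> \<rho>
          = ereal (\<Sum>x\<in>UNIV. cond_prob \<nu> h x * ln (cond_prob \<nu> h x / cond_prob \<rho> h x))"
        using rho_pos[OF \<nu>] by (auto simp: entropy_dist_def)
      moreover have "cond_prob \<nu> h x * ln (cond_prob \<nu> h x / cond_prob \<xi> h x)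
          = cond_prob \<nu> h x * ln (cond_prob \<nu> h x / cond_prob \<rho> h x) + cond_prob \<nu> h x * c x" for x
      proof (cases "0 < cond_prob \<nu> h x")
        case True
        moreover have "cond_prob \<xi> h x \<noteq> 0"
          using True cond_prob_mixture_eq_0[OF \<nu>] by auto
        ultimately show ?thesis
          using rho_pos[OF \<nu> True] by (simp add: c_def ln_div algebra_simps)
      qed simp
      ultimately show ?thesis
        by (simp add: xi[OF \<nu>] sum.distrib)
    qed
    \<comment> \<open>Termwise ln z \<le> z - 1 with z = \<rho>(x|h) / \<xi>(x|h), multiplied by
      \<xi>(x|h).\<close>
    moreover have "(\<Sum>x\<in>UNIV. cond_prob \<xi> h x * c x)
        \<le> (\<Sum>x\<in>UNIV. cond_prob \<rho> h x - cond_prob \<xi> h x)"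
    proof (rule sum_mono)
      fix x
      show "cond_prob \<xi> h x * c x \<le> cond_prob \<rho> h x - cond_prob \<xi> h x"
      proof (cases "cond_prob \<xi> h x = 0")
        case False
        then have "prefix_prob \<xi> (h @ [x]) \<noteq> 0"
          by (auto simp: cond_prob_def)
        \<comment> \<open>Positivity of \<rho> at \<open>x\<close> is available only through members
          of \<open>M\<close>, hence the detour over one that charges
          \<open>h @ [x]\<close>.\<close>
        then obtain \<nu> where \<nu>: "\<nu> \<in> M" "prefix_prob \<nu> (h @ [x]) \<noteq> 0"
          using prefix_prob_mixture_eq_0_iff by blast
        then have "0 < cond_prob \<nu> h x"
          using M prefix_prob_snoc[of \<nu> h x] by auto
        then have "0 < cond_prob \<rho> h x"
          using rho_pos \<nu>(1) by blast
        moreover have xi_pos: "0 < cond_prob \<xi> h x"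
          using False by simp
        ultimately have "c x \<le> cond_prob \<rho> h x / cond_prob \<xi> h x - 1"
          unfolding c_def by (intro ln_le_minus_one divide_pos_pos)
        then show ?thesis
          using xi_pos by (simp add: field_simps)
      qed simp
    qed
    \<comment> \<open>The conditional probabilities of \<xi> sum to \<open>1\<close>, those of
      \<rho> to \<open>0\<close> or \<open>1\<close>; a null history of \<rho> thus needs no
      separate case.\<close>
    moreover have "\<dots> \<le> 0"
      using h sum_cond_prob[OF \<rho>, of h] sum_cond_prob[OF xi_in_seq_dists, of h]
      by (simp add: sum_subtractf)
    ultimately show ?thesis
      by (intro exI[of _ c]) auto
  qed
  moreover have "entropy_dist h \<nu> \<rho> \<noteq> -\<infinity>" for h and \<nu> \<rho> :: "'x stream measure"
    by (simp add: entropy_dist_def)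
  ultimately show ?thesis
    unfolding linear_regret_def by (simp add: xi)
qed

end

theorem theorem6:
  fixes M :: "'x::finite stream measure set"
    and w :: "'x stream measure \<Rightarrow> real"
    and \<xi> :: "'x stream measure"
    and loss :: "'x \<Rightarrow> 'y \<Rightarrow> real"
    and \<Lambda> :: "'x stream measure \<Rightarrow> 'x list \<Rightarrow> 'y"
    and \<Theta> :: "'x stream measure \<Rightarrow> 'x list \<Rightarrow> 'x"
  assumes "countable M"
    and "M \<subseteq> seq_dists"
    and "\<And>\<nu>. \<nu> \<in> M \<Longrightarrow> 0 < w \<nu>"
    and "(w has_sum 1) M"
    and "\<xi> = mixture M w"
    and "\<And>x y. loss x y \<in> {0..1}"
    and "action_scheme loss \<Lambda>"
    and "prediction_scheme \<Theta>"
  shows "(\<forall>h. 0 < prefix_prob \<xi> h \<longrightarrow>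
            pareto_optimal_at h M sq_dist \<xi> \<and>
            pareto_optimal_at h M entropy_dist \<xi> \<and>
            pareto_optimal_at h M (expected_error \<Theta>) \<xi> \<and>
            pareto_optimal_at h M (expected_loss loss \<Lambda>) \<xi>) \<and>
         (\<forall>n. pareto_optimal M (cumulative sq_dist n) \<xi> \<and>
            pareto_optimal M (cumulative entropy_dist n) \<xi> \<and>
            pareto_optimal M (cumulative (expected_error \<Theta>) n) \<xi> \<and>
            pareto_optimal M (cumulative (expected_loss loss \<Lambda>) n) \<xi>)"
proof -
  interpret bayes_mixture M w \<xi>
    using assms by unfold_locales auto
  show ?thesis
    using linear_regret_sq_dist linear_regret_entropy_dist
      linear_regret_expected_error[OF \<open>prediction_scheme \<Theta>\<close>]
      linear_regret_expected_loss[OF \<open>action_scheme loss \<Lambda>\<close>]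
      linear_regret_imp_pareto_optimal_at linear_regret_imp_pareto_optimal_cumulative
    by blast
qed

end
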